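(* Let $A\in\mathbb{R}^{m\times n}$ have full row rank, $b\in\mathbb{R}^m$, let $\lambda,\sigma,\tau>0$, and let $f_1,f_2,f_3:\mathbb{R}^m\to\mathbb{R}$ be strictly convex functions. Consider the four problems in the variable $x\in\mathbb{R}^n$: (P1) $\min \|x\|_1$ s.t. $Ax=b$; (P2) $\min f_1(Ax-b)+\lambda\|x\|_1$; (P3) $\min \|x\|_1$ s.t. $f_2(Ax-b)\le\sigma$; (P4) $\min f_3(Ax-b)$ s.t. $\|x\|_1\le\tau$. Assume the solution set of each problem considered is nonempty, and, for (P4), that $\tau\le\inf\{\|x\|_1: f_3(Ax-b)=f_3^*\}$, where $f_3^*:=\min_{y\in\mathbb{R}^n}f_3(Ay-b)$. Let $x^*$ be a solution to one of the problems (P1), (P2), (P3), (P4). Set $I:=\operatorname{supp}(x^* )$ and $s:=\operatorname{sign}(x^*_I)$. Then $x^*$ is the unique solution of that problem if and only if both of the following hold: 1) the submatrix $A_I$ has full column rank; and 2) there is $y\in\mathbb{R}^m$ such that $A_I^Ty=s$ and $\|A_{I^c}^Ty\|_\infty<1$.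
   Context: For an index set $I\subseteq\{1,\dots,n\}$, $I^c$ is its complement in $\{1,\dots,n\}$, $A_I$ is the submatrix of $A$ formed by the columns $a_i$, $i\in I$, and $x_I$ is the subvector of $x$ formed by the entries $x_i$, $i\in I$. $\operatorname{supp}(x)=\{i:x_i\ne 0\}$, and $\operatorname{sign}$ is applied entrywise. When $I=\emptyset$, $A_I$ is regarded as having full column rank and the equation $A_I^Ty=s$ is vacuous; when $I^c=\emptyset$, the condition $\|A_{I^c}^Ty\|_\infty<1$ is vacuous. *)

theory Defs
  imports "HOL-Analysis.Analysis"
begin

definition strictly_convex :: "('a::real_vector \<Rightarrow> real) \<Rightarrow> bool" where
  "strictly_convex f \<longleftrightarrow>
     (\<forall>x y t. x \<noteq> y \<longrightarrow> 0 < t \<longrightarrow> t < 1 \<longrightarrow>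
        f ((1 - t) *\<^sub>R x + t *\<^sub>R y) < (1 - t) * f x + t * f y)"

definition norm1 :: "real^'n \<Rightarrow> real" where
  "norm1 x = (\<Sum>i\<in>UNIV. \<bar>x $ i\<bar>)"

definition supp :: "real^'n \<Rightarrow> 'n set" where
  "supp x = {i. x $ i \<noteq> 0}"

(* The library's sgn on real^'n is the normalisation x / norm x, not the entrywise sign. *)
definition sign_vec :: "real^'n \<Rightarrow> real^'n" where
  "sign_vec x = (\<chi> i. sgn (x $ i))"

(* The size of an index set I varies, whereas dimensions are types.  So the subvector x_I and the
   column submatrix A_I are represented in the ambient dimension, with the entries (columns)
   outside I set to zero.  The zero columns contribute nothing to the rank or to
   the product A_I x_I, and the corresponding entries of the product with the transpose are zero;
   the lemmas below express the rank, that product and the sup-norm through the columns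
   and entries indexed by I only.  For empty I this gives rank 0 = card I,
   the trivial equation 0 = 0, and sup-norm 0. *)
definition subvec :: "'n set \<Rightarrow> real^'n \<Rightarrow> real^'n" where
  "subvec I x = (\<chi> i. if i \<in> I then x $ i else 0)"

definition subcols :: "'n set \<Rightarrow> real^'n^'m \<Rightarrow> real^'n^'m" where
  "subcols I A = (\<chi> i j. if j \<in> I then A $ i $ j else 0)"

lemma rank_subcols:
  fixes A :: "real^'n^'m"
  shows "rank (subcols I A) = dim ((\<lambda>j. column j A) ` I)"
proof -
  have col: "column j (subcols I A) = (if j \<in> I then column j A else 0)" for j
    by (simp add: subcols_def column_def vec_eq_iff)
  have "columns (subcols I A) \<union> {0} = (\<lambda>j. column j A) ` I \<union> {0}"
    unfolding columns_def col by auto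
  then have "span (columns (subcols I A)) = span ((\<lambda>j. column j A) ` I)"
    by (metis Un_insert_right span_insert_0 sup_bot_right)
  then show ?thesis
    by (metis column_rank_def dim_span)
qed

lemma transpose_subcols_mult_eq_subvec_iff:
  fixes A :: "real^'n^'m"
  shows "transpose (subcols I A) *v y = subvec I z \<longleftrightarrow> (\<forall>i\<in>I. column i A \<bullet> y = z $ i)"
  by (auto simp: vec_eq_iff transpose_def subcols_def subvec_def column_def inner_vec_def
      matrix_vector_mult_def)

lemma infnorm_transpose_subcols_less_1_iff:
  fixes A :: "real^'n^'m"
  shows "infnorm (transpose (subcols I A) *v y) < 1 \<longleftrightarrow> (\<forall>i\<in>I. \<bar>column i A \<bullet> y\<bar> < 1)"
proof -
  have "(transpose (subcols I A) *v y) $ i = (if i \<in> I then column i A \<bullet> y else 0)" for i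
    by (simp add: transpose_def subcols_def column_def inner_vec_def matrix_vector_mult_def)
  then show ?thesis
    by (auto simp: infnorm_Max Basis_vec_def inner_axis split: if_splits)
qed

definition solutions :: "('a \<Rightarrow> real) \<Rightarrow> ('a \<Rightarrow> bool) \<Rightarrow> 'a set" where
  "solutions f feasible = {x. is_arg_min f feasible x}"

definition P1 :: "real^'n^'m \<Rightarrow> real^'m \<Rightarrow> (real^'n) set" where
  "P1 A b = solutions norm1 (\<lambda>x. A *v x = b)"

definition P2 :: "(real^'m \<Rightarrow> real) \<Rightarrow> real \<Rightarrow> real^'n^'m \<Rightarrow> real^'m \<Rightarrow> (real^'n) set" where
  "P2 f lam A b = solutions (\<lambda>x. f (A *v x - b) + lam * norm1 x) (\<lambda>x. True)"

definition P3 :: "(real^'m \<Rightarrow> real) \<Rightarrow> real \<Rightarrow> real^'n^'m \<Rightarrow> real^'m \<Rightarrow> (real^'n) set" where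
  "P3 f \<sigma> A b = solutions norm1 (\<lambda>x. f (A *v x - b) \<le> \<sigma>)"

definition P4 :: "(real^'m \<Rightarrow> real) \<Rightarrow> real \<Rightarrow> real^'n^'m \<Rightarrow> real^'m \<Rightarrow> (real^'n) set" where
  "P4 f \<tau> A b = solutions (\<lambda>x. f (A *v x - b)) (\<lambda>x. norm1 x \<le> \<tau>)"

(* The two infima are taken in ereal, so that an infimum over the empty set is infinity and a
   function unbounded below has infimum -infinity.  Where the minimum over all y is attained,
   unconstrained_min is that minimum. *)
definition unconstrained_min :: "(real^'m \<Rightarrow> real) \<Rightarrow> real^'n^'m \<Rightarrow> real^'m \<Rightarrow> ereal" where
  "unconstrained_min f A b = (INF y. ereal (f (A *v y - b)))"

definition min_norm1_of_minimizers :: "(real^'m \<Rightarrow> real) \<Rightarrow> real^'n^'m \<Rightarrow> real^'m \<Rightarrow> ereal" where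
  "min_norm1_of_minimizers f A b =
     (INF x \<in> {x. ereal (f (A *v x - b)) = unconstrained_min f A b}. ereal (norm1 x))"

end

theory Submission
  imports Defs
begin

text \<open>
  By strict convexity, the product \<^term>\<open>A *v x\<close> and the norm \<^term>\<open>norm1 x\<close> take a single value on
  the solution set of each of the four problems, so this set consists of all \<open>x\<close> with
  \<open>A *v x = A *v xs\<close> and \<open>norm1 x \<le> norm1 xs\<close>.  Hence \<open>xs\<close> is the only solution iff the one-sided
  directional derivative of the norm at \<open>xs\<close> is positive along every nonzero \<open>h\<close> in the kernel of
  \<open>A\<close>.  If no dual certificate exists, the relatively open convex set of all \<open>z\<close> that agree with the
  signs on the support and satisfy \<open>\<bar>z $ i\<bar> < 1\<close> off it is disjoint from the row space of \<open>A\<close>, and the normal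
  of a separating hyperplane is a kernel vector with nonpositive directional derivative.
\<close>

section \<open>The norm and its directional derivative\<close>

lemma norm1_nonneg: "0 \<le> norm1 x"
  by (simp add: norm1_def sum_nonneg)

lemma norm1_eq_0_iff: "norm1 x = 0 \<longleftrightarrow> x = 0"
  by (simp add: norm1_def sum_nonneg_eq_0_iff vec_eq_iff)

lemma norm1_scaleR: "norm1 (c *\<^sub>R x) = \<bar>c\<bar> * norm1 x"
  by (simp add: norm1_def abs_mult sum_distrib_left)

lemma norm1_triangle: "norm1 (x + y) \<le> norm1 x + norm1 y"
  unfolding norm1_def by (simp add: sum.distrib[symmetric] sum_mono abs_triangle_ineq)

lemma norm1_convex:
  assumes "0 \<le> t" "t \<le> 1"
  shows "norm1 ((1 - t) *\<^sub>R x + t *\<^sub>R y) \<le> (1 - t) * norm1 x + t * norm1 y"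
  using norm1_triangle[of "(1 - t) *\<^sub>R x" "t *\<^sub>R y"] assms by (simp add: norm1_scaleR)

text \<open>This is the largest value of \<open>z \<bullet> h\<close> over the subgradients
  \<open>z\<close> of \<open>norm1\<close> at \<open>x\<close>; an entry where \<open>x\<close>
  vanishes contributes \<open>\<bar>h $ i\<bar>\<close> because of the kink.\<close>

definition norm1_deriv :: "real^'n \<Rightarrow> real^'n \<Rightarrow> real" where
  "norm1_deriv x h = (\<Sum>i\<in>UNIV. if x $ i = 0 then \<bar>h $ i\<bar> else sgn (x $ i) * h $ i)"

text \<open>Convexity, entry by entry: where \<open>x $ i\<close> is nonzero the absolute value lies
  above its tangent, and where it is zero equality holds.\<close>

lemma norm1_add_ge: "norm1 x + norm1_deriv x h \<le> norm1 (x + h)"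
  unfolding norm1_def norm1_deriv_def sum.distrib[symmetric]
  by (intro sum_mono) (auto simp: sgn_real_def)

text \<open>Along a short enough step no nonzero entry changes sign, so the norm is affine there and
  the derivative gives an exact value instead of a limit.\<close>

lemma norm1_small_step:
  obtains e where "0 < e" "norm1 (x + e *\<^sub>R h) = norm1 x + e * norm1_deriv x h"
proof -
  have "\<forall>\<^sub>F e in at_right 0.
      \<bar>x $ i + e * h $ i\<bar> = \<bar>x $ i\<bar> + e * (if x $ i = 0 then \<bar>h $ i\<bar> else sgn (x $ i) * h $ i)" for i
  proof -
    have lim: "((\<lambda>e. x $ i + e * h $ i) \<longlongrightarrow> x $ i) (at_right 0)"
      by (auto intro!: tendsto_eq_intros)
    have pos: "\<forall>\<^sub>F e in at_right (0::real). 0 < e"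
      by (simp add: eventually_at_right_less)
    consider "x $ i = 0" | "x $ i > 0" | "x $ i < 0" by linarith
    then show ?thesis
    proof cases
      case 1
      from pos show ?thesis
        by (rule eventually_mono) (use 1 in \<open>simp add: abs_mult\<close>)
    next
      case 2
      from order_tendstoD(1)[OF lim 2] show ?thesis
        by (rule eventually_mono) (use 2 in auto)
    next
      case 3
      from order_tendstoD(2)[OF lim 3] show ?thesis
        by (rule eventually_mono) (use 3 in auto)
    qed
  qed
  \<comment> \<open>There are finitely many coordinates, so a single \<open>e\<close> serves all of
    them.\<close>
  then have "\<forall>\<^sub>F e in at_right 0. \<forall>i.
      \<bar>x $ i + e * h $ i\<bar> = \<bar>x $ i\<bar> + e * (if x $ i = 0 then \<bar>h $ i\<bar> else sgn (x $ i) * h $ i)"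
    by (rule eventually_all_finite)
  then have "\<forall>\<^sub>F e in at_right 0. norm1 (x + e *\<^sub>R h) = norm1 x + e * norm1_deriv x h"
    by (rule eventually_mono)
      (simp add: norm1_def norm1_deriv_def sum_distrib_left sum.distrib[symmetric])
  moreover have "\<forall>\<^sub>F e in at_right (0::real). 0 < e"
    by (simp add: eventually_at_right_less)
  ultimately have "\<forall>\<^sub>F e in at_right 0. 0 < e \<and> norm1 (x + e *\<^sub>R h) = norm1 x + e * norm1_deriv x h"
    by eventually_elim simp
  then obtain e where "0 < e" "norm1 (x + e *\<^sub>R h) = norm1 x + e * norm1_deriv x h"
    using eventually_happens'[OF trivial_limit_at_right_real] by blast
  then show thesis by (rule that)
qed

text \<open>A kernel direction with nonpositive derivative yields a second point by a small step;
  conversely, convexity makes the norm grow along any direction of positive derivative.\<close>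

lemma norm1_sublevel_singleton_iff:
  fixes A :: "real^'n^'m"
  shows "{x. A *v x = A *v xs \<and> norm1 x \<le> norm1 xs} = {xs} \<longleftrightarrow>
    (\<forall>h. A *v h = 0 \<longrightarrow> h \<noteq> 0 \<longrightarrow> 0 < norm1_deriv xs h)"
proof
  assume L: "{x. A *v x = A *v xs \<and> norm1 x \<le> norm1 xs} = {xs}"
  show "\<forall>h. A *v h = 0 \<longrightarrow> h \<noteq> 0 \<longrightarrow> 0 < norm1_deriv xs h"
  proof (intro allI impI)
    fix h assume h: "A *v h = 0" "h \<noteq> 0"
    obtain e where e: "0 < e" "norm1 (xs + e *\<^sub>R h) = norm1 xs + e * norm1_deriv xs h"
      by (rule norm1_small_step)
    have "A *v (xs + e *\<^sub>R h) = A *v xs"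
      using h by (simp add: matrix_vector_right_distrib matrix_vector_mult_scaleR)
    moreover have "xs + e *\<^sub>R h \<noteq> xs" using e h by simp
    ultimately have "\<not> norm1 (xs + e *\<^sub>R h) \<le> norm1 xs" using L by blast
    then have "0 < e * norm1_deriv xs h" using e by simp
    then show "0 < norm1_deriv xs h" using e by (simp add: zero_less_mult_iff)
  qed
next
  assume R: "\<forall>h. A *v h = 0 \<longrightarrow> h \<noteq> 0 \<longrightarrow> 0 < norm1_deriv xs h"
  have "x = xs" if x: "A *v x = A *v xs" "norm1 x \<le> norm1 xs" for x
  proof (rule ccontr)
    assume "x \<noteq> xs"
    moreover have "A *v (x - xs) = 0" using x by (simp add: matrix_vector_mult_diff_distrib)
    ultimately have "0 < norm1_deriv xs (x - xs)" using R by simp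
    then show False using norm1_add_ge[of xs "x - xs"] x by simp
  qed
  then show "{x. A *v x = A *v xs \<and> norm1 x \<le> norm1 xs} = {xs}" by auto
qed

section \<open>Full column rank\<close>

lemma matrix_vector_mult_supp_subset:
  fixes A :: "real^'n^'m"
  assumes "supp h \<subseteq> I"
  shows "A *v h = (\<Sum>i\<in>I. h $ i *\<^sub>R column i A)"
proof -
  have "A *v h = (\<Sum>i\<in>UNIV. h $ i *\<^sub>R column i A)"
    by (simp add: matrix_mult_sum scalar_mult_eq_scaleR)
  also have "\<dots> = (\<Sum>i\<in>I. h $ i *\<^sub>R column i A)"
    using assms by (intro sum.mono_neutral_right) (auto simp: supp_def)
  finally show ?thesis .
qed

text \<open>The rank sees the columns as a set, in which equal columns collapse. Both directions
  therefore treat injectivity of the column map separately from independence.\<close>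

lemma rank_subcols_eq_card_iff:
  fixes A :: "real^'n^'m"
  shows "rank (subcols I A) = card I \<longleftrightarrow> (\<forall>h. supp h \<subseteq> I \<longrightarrow> A *v h = 0 \<longrightarrow> h = 0)"
proof
  assume rk: "rank (subcols I A) = card I"
  let ?C = "(\<lambda>j. column j A) ` I"
  \<comment> \<open>The chain \<open>dim ?C \<le> card ?C \<le> card I\<close> collapses to
    equalities, so the columns are distinct and independent.\<close>
  have "dim ?C \<le> card ?C" by (rule dim_le_card') simp
  moreover have "card ?C \<le> card I" by (rule card_image_le) simp
  ultimately have c: "card ?C = card I" "dim ?C = card ?C"
    using rk by (simp_all add: rank_subcols)
  have inj: "inj_on (\<lambda>j. column j A) I"
    using c(1) by (simp add: eq_card_imp_inj_on)
  have ind: "independent ?C"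
    by (rule card_le_dim_spanning[of ?C "span ?C"]) (auto simp: span_superset c)
  show "\<forall>h. supp h \<subseteq> I \<longrightarrow> A *v h = 0 \<longrightarrow> h = 0"
  proof (intro allI impI)
    fix h assume h: "supp h \<subseteq> I" "A *v h = 0"
    let ?u = "\<lambda>v. h $ inv_into I (\<lambda>j. column j A) v"
    have "(\<Sum>v\<in>?C. ?u v *\<^sub>R v) = (\<Sum>i\<in>I. h $ i *\<^sub>R column i A)"
      by (subst sum.reindex[OF inj]) (simp add: inv_into_f_f[OF inj])
    also have "\<dots> = 0" using h matrix_vector_mult_supp_subset by metis
    finally have z: "(\<Sum>v\<in>?C. ?u v *\<^sub>R v) = 0" .
    have "h $ i = 0" if "i \<in> I" for i
      using independentD[OF ind _ _ z, of "column i A"] that by (simp add: inv_into_f_f[OF inj])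
    then show "h = 0" using h by (auto simp: supp_def vec_eq_iff)
  qed
next
  assume R: "\<forall>h. supp h \<subseteq> I \<longrightarrow> A *v h = 0 \<longrightarrow> h = 0"
  let ?C = "(\<lambda>j. column j A) ` I"
  have sum0: "\<forall>i\<in>I. u i = 0" if "(\<Sum>i\<in>I. u i *\<^sub>R column i A) = 0" for u
  proof -
    let ?h = "(\<chi> i. if i \<in> I then u i else 0) :: real^'n"
    have s: "supp ?h \<subseteq> I" by (auto simp: supp_def)
    have "A *v ?h = 0" using matrix_vector_mult_supp_subset[OF s, of A] that by simp
    then have "?h = 0" using R s by blast
    then show ?thesis by (auto simp: vec_eq_iff split: if_splits)
  qed
  have inj: "inj_on (\<lambda>j. column j A) I"
  proof (rule inj_onI, rule ccontr)
    fix i j assume ij: "i \<in> I" "j \<in> I" "column i A = column j A" "i \<noteq> j"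
    \<comment> \<open>Equal columns \<open>i\<close> and \<open>j\<close> make the difference of the
      two unit vectors a kernel vector supported in \<open>I\<close>.\<close>
    let ?u = "\<lambda>k. (if k = i then 1 else 0) - (if k = j then 1 else (0::real))"
    have "(\<Sum>k\<in>I. ?u k *\<^sub>R column k A) = 0"
      using ij by (simp add: scaleR_diff_left sum_subtractf if_distrib[of "\<lambda>c. c *\<^sub>R _"] cong: if_cong)
    from sum0[OF this] have "?u i = 0" using ij(1) by blast
    with ij show False by simp
  qed
  have "independent ?C"
  proof (rule independent_if_scalars_zero)
    fix u v assume z: "(\<Sum>v\<in>?C. u v *\<^sub>R v) = 0" and v: "v \<in> ?C"
    have "(\<Sum>i\<in>I. u (column i A) *\<^sub>R column i A) = 0"
      using z by (simp add: sum.reindex[OF inj])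
    from sum0[OF this] show "u v = 0" using v by auto
  qed simp
  then have "dim ?C = card I"
    by (simp add: dim_eq_card_independent card_image[OF inj])
  then show "rank (subcols I A) = card I" by (simp add: rank_subcols)
qed

section \<open>Dual certificates\<close>

lemma column_inner_eq_transpose: "column i A \<bullet> y = (transpose A *v y) $ i"
  for A :: "real^'n^'m"
  by (simp add: transpose_def column_def inner_vec_def matrix_vector_mult_def)

text \<open>This places \<open>transpose A *v y\<close> in the relative interior of the
  subdifferential of \<open>norm1\<close> at \<open>x\<close>.\<close>

definition dual_certificate :: "real^'n^'m \<Rightarrow> real^'n \<Rightarrow> real^'m \<Rightarrow> bool" where
  "dual_certificate A x y \<longleftrightarrow>
    (\<forall>i\<in>supp x. (transpose A *v y) $ i = sgn (x $ i)) \<and>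
    (\<forall>i\<in>- supp x. \<bar>(transpose A *v y) $ i\<bar> < 1)"

text \<open>The vector \<open>transpose A *v y\<close> is orthogonal to the kernel, and its product
  with \<open>h\<close> is bounded termwise by the derivative. By full rank \<open>h\<close> has a
  nonzero entry off the support, where the bound is strict.\<close>

lemma norm1_deriv_pos:
  fixes A :: "real^'n^'m"
  assumes rk: "rank (subcols (supp xs) A) = card (supp xs)"
    and y: "dual_certificate A xs y"
    and h: "A *v h = 0" "h \<noteq> 0"
  shows "0 < norm1_deriv xs h"
proof -
  let ?z = "transpose A *v y"
  have "\<not> supp h \<subseteq> supp xs"
    using rk h by (auto simp: rank_subcols_eq_card_iff)
  then obtain k where k: "h $ k \<noteq> 0" "xs $ k = 0" by (auto simp: supp_def)
  have z: "\<bar>?z $ i\<bar> < 1" if "xs $ i = 0" for i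
    using y that by (simp add: dual_certificate_def supp_def)
  have strict: "?z $ i * h $ i < \<bar>h $ i\<bar>" if "xs $ i = 0" "h $ i \<noteq> 0" for i
  proof -
    have "?z $ i * h $ i \<le> \<bar>?z $ i\<bar> * \<bar>h $ i\<bar>" by (metis abs_ge_self abs_mult)
    also have "\<dots> < 1 * \<bar>h $ i\<bar>" using z that by (intro mult_strict_right_mono) auto
    finally show ?thesis by simp
  qed
  have "0 = y \<bullet> (A *v h)" using h by simp
  also have "\<dots> = ?z \<bullet> h" by (simp add: dot_lmul_matrix)
  also have "\<dots> = (\<Sum>i\<in>UNIV. ?z $ i * h $ i)" by (simp add: inner_vec_def)
  also have "\<dots> < norm1_deriv xs h"
    unfolding norm1_deriv_def
  proof (rule sum_strict_mono_ex1)
    show "\<forall>i\<in>UNIV. ?z $ i * h $ i \<le> (if xs $ i = 0 then \<bar>h $ i\<bar> else sgn (xs $ i) * h $ i)"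
    proof
      fix i
      show "?z $ i * h $ i \<le> (if xs $ i = 0 then \<bar>h $ i\<bar> else sgn (xs $ i) * h $ i)"
        using strict[of i] y by (cases "h $ i = 0") (auto simp: dual_certificate_def supp_def)
    qed
    show "\<exists>i\<in>UNIV. ?z $ i * h $ i < (if xs $ i = 0 then \<bar>h $ i\<bar> else sgn (xs $ i) * h $ i)"
      using strict k by auto
  qed simp
  finally show ?thesis .
qed

text \<open>On vectors supported in \<open>supp xs\<close> the derivative is linear, so it cannot be
  positive at both \<open>h\<close> and \<open>- h\<close>.\<close>

lemma rank_subcols_supp:
  fixes A :: "real^'n^'m"
  assumes pos: "\<And>h. A *v h = 0 \<Longrightarrow> h \<noteq> 0 \<Longrightarrow> 0 < norm1_deriv xs h"
  shows "rank (subcols (supp xs) A) = card (supp xs)"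
  unfolding rank_subcols_eq_card_iff
proof (intro allI impI, rule ccontr)
  fix h assume h: "supp h \<subseteq> supp xs" "A *v h = 0" "h \<noteq> 0"
  have "A *v (- h) = 0" using h matrix_vector_mult_scaleR[of A "-1" h] by simp
  then have "0 < norm1_deriv xs (- h)" using pos h by simp
  moreover have "norm1_deriv xs (- h) = - norm1_deriv xs h"
    unfolding norm1_deriv_def sum_negf[symmetric]
    using h(1) by (intro sum.cong) (auto simp: supp_def)
  ultimately show False using pos[OF h(2,3)] by simp
qed

lemma dual_certificate_exists:
  fixes A :: "real^'n^'m"
  assumes pos: "\<And>h. A *v h = 0 \<Longrightarrow> h \<noteq> 0 \<Longrightarrow> 0 < norm1_deriv xs h"
  shows "\<exists>y. dual_certificate A xs y"
proof (rule ccontr)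
  assume none: "\<nexists>y. dual_certificate A xs y"
  \<comment> \<open>\<open>C\<close> is the relative interior of the subdifferential at
    \<open>xs\<close> and \<open>R\<close> is the row space; a common point would be a
    certificate.\<close>
  define C where
    "C = (\<Inter>i. {z :: real^'n. z $ i \<in> (if xs $ i = 0 then {-1<..<1} else {sgn (xs $ i)})})"
  define R where "R = range (\<lambda>y. transpose A *v y)"
  have "convex C"
    unfolding C_def
  proof (intro convex_INT)
    fix i
    have "convex ((\<lambda>z :: real^'n. z $ i) -` (if xs $ i = 0 then {-1<..<1} else {sgn (xs $ i)}))"
      by (intro convex_linear_vimage) (auto simp: linear_iff)
    then show "convex {z :: real^'n. z $ i \<in> (if xs $ i = 0 then {-1<..<1} else {sgn (xs $ i)})}"
      by (simp add: vimage_def)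
  qed
  moreover have subR: "subspace R"
    unfolding R_def by (intro linear_subspace_image subspace_UNIV matrix_vector_mul_linear)
  then have "convex R" by (rule subspace_imp_convex)
  \<comment> \<open>As \<open>t\<close> tends to 1, these points of \<open>C\<close> approach a
    maximizer of the inner product with \<open>h\<close> over the closure of
    \<open>C\<close>.\<close>
  moreover have inC: "(\<chi> i. if xs $ i = 0 then t * sgn (h $ i) else sgn (xs $ i)) \<in> C"
    if "0 < t" "t < 1" for t and h :: "real^'n"
    using that by (auto simp: C_def sgn_real_def)
  then have "C \<noteq> {}" using inC[of "1/2"] by fastforce
  moreover have "R \<noteq> {}" by (auto simp: R_def)
  moreover have "C \<inter> R = {}"
  proof -
    have "dual_certificate A xs y" if "transpose A *v y \<in> C" for y
    proof -
      have "(transpose A *v y) $ i \<in> (if xs $ i = 0 then {-1<..<1} else {sgn (xs $ i)})" for i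
        using that unfolding C_def by blast
      then show ?thesis
        unfolding dual_certificate_def supp_def
        by (metis (mono_tags, lifting) ComplD abs_less_iff greaterThanLessThan_iff mem_Collect_eq
            minus_less_iff singletonD)
    qed
    then show ?thesis using none by (auto simp: R_def)
  qed
  ultimately obtain h c where h: "h \<noteq> 0" "\<forall>z\<in>C. h \<bullet> z \<le> c" "\<forall>z\<in>R. h \<bullet> z \<ge> c"
    using separating_hyperplane_sets[of C R] by blast
  have "c \<le> 0" using h(3) subspace_0[OF subR] by fastforce
  have "A *v h = 0"
  proof (rule ccontr)
    assume nz: "A *v h \<noteq> 0"
    define q where "q = (A *v h) \<bullet> (A *v h)"
    have "q > 0" using nz by (simp add: q_def)
    \<comment> \<open>A functional bounded below on a subspace vanishes there: the factor is chosen
      so that this point of \<open>R\<close> gives \<open>c - 1\<close>, below the bound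
      \<open>c\<close>.\<close>
    have "h \<bullet> (transpose A *v (((c - 1) / q) *\<^sub>R (A *v h))) = ((c - 1) / q) * q"
      by (metis dot_lmul_matrix inner_commute inner_scaleR_left q_def transpose_matrix_vector)
    also have "\<dots> < c" using \<open>q > 0\<close> by simp
    finally show False using h(3) unfolding R_def by (meson not_le rangeI)
  qed
  \<comment> \<open>\<open>a\<close> and \<open>d\<close> are the parts of the derivative on and off
    the support.\<close>
  define a where "a = (\<Sum>i\<in>UNIV. if xs $ i = 0 then 0 else sgn (xs $ i) * h $ i)"
  define d where "d = (\<Sum>i\<in>UNIV. if xs $ i = 0 then \<bar>h $ i\<bar> else 0)"
  have "t * d \<le> - a" if t: "0 < t" "t < 1" for t
  proof -
    have "h \<bullet> (\<chi> i. if xs $ i = 0 then t * sgn (h $ i) else sgn (xs $ i)) = a + t * d"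
      unfolding inner_vec_def a_def d_def sum_distrib_left sum.distrib[symmetric]
      by (intro sum.cong) (auto simp: abs_sgn)
    then show ?thesis using h(2) inC[OF t, of h] \<open>c \<le> 0\<close> by fastforce
  qed
  \<comment> \<open>In the limit \<open>t\<close> to 1 the derivative \<open>a + d\<close> turns out
    nonpositive, against \<open>pos\<close>.\<close>
  then have "d \<le> - a" by (rule field_le_mult_one_interval)
  moreover have "norm1_deriv xs h = a + d"
    unfolding norm1_deriv_def a_def d_def sum.distrib[symmetric] by (intro sum.cong) auto
  ultimately show False using pos[OF \<open>A *v h = 0\<close> h(1)] by simp
qed

section \<open>The solution sets\<close>

lemma strictly_convex_affine_less:
  fixes A :: "real^'n^'m"
  assumes "strictly_convex f" "A *v x \<noteq> A *v y" "0 < t" "t < 1"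
  shows "f (A *v ((1 - t) *\<^sub>R x + t *\<^sub>R y) - b) < (1 - t) * f (A *v x - b) + t * f (A *v y - b)"
proof -
  have "A *v ((1 - t) *\<^sub>R x + t *\<^sub>R y) - b = (1 - t) *\<^sub>R (A *v x - b) + t *\<^sub>R (A *v y - b)"
    by (simp add: matrix_vector_right_distrib matrix_vector_mult_scaleR algebra_simps)
  then show ?thesis using assms by (simp add: strictly_convex_def)
qed

text \<open>Strict convexity says nothing when \<open>A\<close> maps \<open>x\<close> and
  \<open>y\<close> to the same point; there both sides coincide.\<close>

lemma strictly_convex_affine_le:
  fixes A :: "real^'n^'m"
  assumes "strictly_convex f" "0 < t" "t < 1"
  shows "f (A *v ((1 - t) *\<^sub>R x + t *\<^sub>R y) - b) \<le> (1 - t) * f (A *v x - b) + t * f (A *v y - b)"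
proof (cases "A *v x = A *v y")
  case True
  then have "A *v ((1 - t) *\<^sub>R x + t *\<^sub>R y) = A *v y"
    by (simp add: matrix_vector_right_distrib matrix_vector_mult_scaleR algebra_simps)
  then show ?thesis using True by (simp add: algebra_simps)
next
  case False
  then show ?thesis using strictly_convex_affine_less assms by (intro less_imp_le) blast
qed

text \<open>Continuity at \<open>t = 0\<close>: a strict bound survives a small move toward any
  other point. This gives the slack for moving toward 0 in \<open>P3\<close> and toward a better
  point in \<open>P4\<close>.\<close>

lemma convex_combination_less:
  fixes u v c :: real
  assumes "u < c"
  obtains t where "0 < t" "t < 1" "(1 - t) * u + t * v < c"
proof -
  have "((\<lambda>t. (1 - t) * u + t * v) \<longlongrightarrow> u) (at_right 0)"
    by (auto intro!: tendsto_eq_intros)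
  from order_tendstoD(2)[OF this assms]
  have "\<forall>\<^sub>F t in at_right 0. (1 - t) * u + t * v < c" .
  moreover have "\<forall>\<^sub>F t in at_right 0. t \<in> {0<..<1::real}"
    by (rule eventually_at_right_real) simp
  ultimately have "\<forall>\<^sub>F t in at_right 0. 0 < t \<and> t < 1 \<and> (1 - t) * u + t * v < c"
    by eventually_elim simp
  then show thesis
    using eventually_happens'[OF trivial_limit_at_right_real] that by blast
qed

lemma P1_eq_sublevel:
  assumes "xs \<in> P1 A b"
  shows "P1 A b = {x. A *v x = A *v xs \<and> norm1 x \<le> norm1 xs}"
  using assms by (force simp: P1_def solutions_def is_arg_min_def)

text \<open>If two solutions had different images, their midpoint would have a smaller objective.
  With equal images the \<open>f\<close> terms cancel and \<open>lam > 0\<close> leaves the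
  comparison of norms.\<close>

lemma P2_eq_sublevel:
  assumes f: "strictly_convex f" and lam: "lam > 0" and xs: "xs \<in> P2 f lam A b"
  shows "P2 f lam A b = {x. A *v x = A *v xs \<and> norm1 x \<le> norm1 xs}"
proof -
  let ?F = "\<lambda>x. f (A *v x - b) + lam * norm1 x"
  have P2: "x \<in> P2 f lam A b \<longleftrightarrow> (\<forall>y. ?F x \<le> ?F y)" for x
    by (auto simp: P2_def solutions_def is_arg_min_def not_less)
  have A: "A *v x = A *v xs" if x: "x \<in> P2 f lam A b" for x
  proof (rule ccontr)
    assume ne: "A *v x \<noteq> A *v xs"
    let ?m = "(1 - 1/2) *\<^sub>R x + (1/2) *\<^sub>R xs"
    have "f (A *v ?m - b) < (1 - 1/2) * f (A *v x - b) + (1/2) * f (A *v xs - b)"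
      using f ne by (rule strictly_convex_affine_less) auto
    moreover have "lam * norm1 ?m \<le> lam * ((1 - 1/2) * norm1 x + (1/2) * norm1 xs)"
      using lam by (intro mult_left_mono norm1_convex) auto
    moreover have "?F x \<le> ?F ?m" "?F xs \<le> ?F ?m" using x xs P2 by blast+
    ultimately show False by (simp add: algebra_simps)
  qed
  show ?thesis
  proof (intro set_eqI iffI)
    fix x assume x: "x \<in> P2 f lam A b"
    then have "?F x \<le> ?F xs" using P2 by blast
    then show "x \<in> {x. A *v x = A *v xs \<and> norm1 x \<le> norm1 xs}"
      using A[OF x] lam by simp
  next
    fix x assume "x \<in> {x. A *v x = A *v xs \<and> norm1 x \<le> norm1 xs}"
    then have "?F x \<le> ?F xs" using lam by simp
    then show "x \<in> P2 f lam A b" using xs order_trans unfolding P2 by blast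
  qed
qed

text \<open>With different images the midpoint of two solutions satisfies the constraint strictly,
  which leaves room to shrink it toward 0 and lower the norm.\<close>

lemma P3_eq_sublevel:
  assumes f: "strictly_convex f" and xs: "xs \<in> P3 f \<sigma> A b"
  shows "P3 f \<sigma> A b = {x. A *v x = A *v xs \<and> norm1 x \<le> norm1 xs}"
proof -
  have P3: "x \<in> P3 f \<sigma> A b \<longleftrightarrow>
      f (A *v x - b) \<le> \<sigma> \<and> (\<forall>y. f (A *v y - b) \<le> \<sigma> \<longrightarrow> norm1 x \<le> norm1 y)" for x
    by (auto simp: P3_def solutions_def is_arg_min_def not_less)
  have A: "A *v x = A *v xs" if x: "x \<in> P3 f \<sigma> A b" for x
  proof (rule ccontr)
    assume ne: "A *v x \<noteq> A *v xs"
    let ?m = "(1 - 1/2) *\<^sub>R x + (1/2) *\<^sub>R xs"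
    have eq: "norm1 x = norm1 xs" using x xs P3 by (meson order_antisym)
    have "f (A *v ?m - b) < (1 - 1/2) * f (A *v x - b) + (1/2) * f (A *v xs - b)"
      using f ne by (rule strictly_convex_affine_less) auto
    also have "\<dots> \<le> \<sigma>" using x xs unfolding P3 by simp
    finally obtain t where t: "0 < t" "t < 1" "(1 - t) * f (A *v ?m - b) + t * f (A *v 0 - b) < \<sigma>"
      by (rule convex_combination_less)
    then have "f (A *v ((1 - t) *\<^sub>R ?m + t *\<^sub>R 0) - b) \<le> \<sigma>"
      using strictly_convex_affine_le[OF f t(1,2), of A ?m 0 b] by linarith
    then have "norm1 xs \<le> norm1 ((1 - t) *\<^sub>R ?m + t *\<^sub>R 0)" using xs P3 by blast
    also have "\<dots> = (1 - t) * norm1 ?m" 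
      using t by (simp only: scaleR_zero_right add_0_right norm1_scaleR)
    also have "\<dots> \<le> (1 - t) * norm1 xs"
      using t norm1_convex[of "1/2" x xs] eq by (intro mult_left_mono) auto
    \<comment> \<open>Shrinking fails to lower the norm only when the norm is zero; then both
      solutions are 0 and their images agree.\<close>
    finally have "norm1 xs \<le> 0" using t by (simp add: algebra_simps mult_le_0_iff)
    then have "xs = 0" "x = 0"
      using eq norm1_nonneg[of xs] norm1_eq_0_iff by (metis order_antisym)+
    then show False using ne by simp
  qed
  show ?thesis
  proof (intro set_eqI iffI)
    fix x assume x: "x \<in> P3 f \<sigma> A b"
    then show "x \<in> {x. A *v x = A *v xs \<and> norm1 x \<le> norm1 xs}"
      using A[OF x] xs P3 by blast
  next
    fix x assume "x \<in> {x. A *v x = A *v xs \<and> norm1 x \<le> norm1 xs}"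
    then show "x \<in> P3 f \<sigma> A b" using xs order_trans unfolding P3 by force
  qed
qed

text \<open>The bound on \<open>\<tau>\<close> makes the norm constraint active at every solution.
  The midpoint of two solutions is feasible by convexity, so strict convexity again gives equal
  images.\<close>

lemma P4_eq_sublevel:
  assumes f: "strictly_convex f" and \<tau>: "ereal \<tau> \<le> min_norm1_of_minimizers f A b"
    and xs: "xs \<in> P4 f \<tau> A b"
  shows "P4 f \<tau> A b = {x. A *v x = A *v xs \<and> norm1 x \<le> norm1 xs}"
proof -
  have P4: "x \<in> P4 f \<tau> A b \<longleftrightarrow>
      norm1 x \<le> \<tau> \<and> (\<forall>y. norm1 y \<le> \<tau> \<longrightarrow> f (A *v x - b) \<le> f (A *v y - b))" for x
    by (auto simp: P4_def solutions_def is_arg_min_def not_less)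
  \<comment> \<open>A solution in the interior of the ball would be a global minimizer of \<open>f (A *v x - b)\<close>.\<close>
  have norm: "norm1 x = \<tau>" if x: "x \<in> P4 f \<tau> A b" for x
  proof (rule ccontr)
    assume "norm1 x \<noteq> \<tau>"
    then have less: "norm1 x < \<tau>" using x P4 by fastforce
    have "f (A *v x - b) \<le> f (A *v y - b)" for y
    proof (rule ccontr)
      assume n: "\<not> f (A *v x - b) \<le> f (A *v y - b)"
      obtain t where t: "0 < t" "t < 1" "(1 - t) * norm1 x + t * norm1 y < \<tau>"
        using less by (rule convex_combination_less)
      have "norm1 ((1 - t) *\<^sub>R x + t *\<^sub>R y) \<le> \<tau>"
        using norm1_convex[of t x y] t by linarith
      then have "f (A *v x - b) \<le> f (A *v ((1 - t) *\<^sub>R x + t *\<^sub>R y) - b)"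
        using x P4 by blast
      also have "\<dots> \<le> (1 - t) * f (A *v x - b) + t * f (A *v y - b)"
        using f t(1,2) by (rule strictly_convex_affine_le)
      finally have "t * f (A *v x - b) \<le> t * f (A *v y - b)" by (simp add: algebra_simps)
      then show False using n t by simp
    qed
    then have "unconstrained_min f A b = ereal (f (A *v x - b))"
      unfolding unconstrained_min_def by (intro antisym INF_lower INF_greatest) auto
    \<comment> \<open>Since \<open>x\<close> is a global minimizer, its norm is at least the
      infimum, hence at least \<open>\<tau>\<close>.\<close>
    then have "min_norm1_of_minimizers f A b \<le> ereal (norm1 x)"
      unfolding min_norm1_of_minimizers_def by (intro INF_lower) simp
    then have "ereal \<tau> \<le> ereal (norm1 x)" using \<tau> by (rule order_trans[rotated])
    then show False using less by simp
  qed
  have A: "A *v x = A *v xs" if x: "x \<in> P4 f \<tau> A b" for x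
  proof (rule ccontr)
    assume ne: "A *v x \<noteq> A *v xs"
    let ?m = "(1 - 1/2) *\<^sub>R x + (1/2) *\<^sub>R xs"
    have "f (A *v ?m - b) < (1 - 1/2) * f (A *v x - b) + (1/2) * f (A *v xs - b)"
      using f ne by (rule strictly_convex_affine_less) auto
    moreover have "norm1 ?m \<le> \<tau>"
      using norm1_convex[of "1/2" x xs] norm[OF x] norm[OF xs] by simp
    then have "f (A *v x - b) \<le> f (A *v ?m - b)" "f (A *v xs - b) \<le> f (A *v ?m - b)"
      using x xs P4 by blast+
    ultimately show False by (simp add: algebra_simps)
  qed
  show ?thesis
  proof (intro set_eqI iffI)
    fix x assume x: "x \<in> P4 f \<tau> A b"
    then show "x \<in> {x. A *v x = A *v xs \<and> norm1 x \<le> norm1 xs}"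
      using A[OF x] norm[OF x] norm[OF xs] by simp
  next
    fix x assume "x \<in> {x. A *v x = A *v xs \<and> norm1 x \<le> norm1 xs}"
    then show "x \<in> P4 f \<tau> A b" using xs norm[OF xs] unfolding P4 by simp
  qed
qed

theorem theorem1:
  fixes A :: "real^'n^'m" and b :: "real^'m"
    and lam \<sigma> \<tau> :: real
    and f\<^sub>1 f\<^sub>2 f\<^sub>3 :: "real^'m \<Rightarrow> real"
    and S :: "(real^'n) set" and xs s :: "real^'n" and I :: "'n set"
  assumes "rank A = CARD('m)"
    and "lam > 0" and "\<sigma> > 0" and "\<tau> > 0"
    and "strictly_convex f\<^sub>1" and "strictly_convex f\<^sub>2" and "strictly_convex f\<^sub>3"
    and "S = P1 A b \<or> S = P2 f\<^sub>1 lam A b \<or> S = P3 f\<^sub>2 \<sigma> A b \<or>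
         (S = P4 f\<^sub>3 \<tau> A b \<and> ereal \<tau> \<le> min_norm1_of_minimizers f\<^sub>3 A b)"
    and "xs \<in> S"
    and "I = supp xs" and "s = subvec I (sign_vec xs)"
  shows "S = {xs} \<longleftrightarrow>
           rank (subcols I A) = card I \<and>
           (\<exists>y::real^'m. transpose (subcols I A) *v y = s \<and>
                         infnorm (transpose (subcols (- I) A) *v y) < 1)"
proof -
  \<comment> \<open>All four problems reduce to this one set, so the rest is independent of the
    problem chosen.\<close>
  have S: "S = {x. A *v x = A *v xs \<and> norm1 x \<le> norm1 xs}"
    using assms(8)
  proof (elim disjE conjE)
    assume "S = P1 A b"
    then show ?thesis using P1_eq_sublevel[of xs A b] assms(9) by simp
  next
    assume "S = P2 f\<^sub>1 lam A b"
    then show ?thesis using P2_eq_sublevel[OF assms(5,2), of xs A b] assms(9) by simp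
  next
    assume "S = P3 f\<^sub>2 \<sigma> A b"
    then show ?thesis using P3_eq_sublevel[OF assms(6), of xs \<sigma> A b] assms(9) by simp
  next
    assume "S = P4 f\<^sub>3 \<tau> A b" "ereal \<tau> \<le> min_norm1_of_minimizers f\<^sub>3 A b"
    then show ?thesis using P4_eq_sublevel[OF assms(7), of \<tau> A b xs] assms(9) by simp
  qed
  \<comment> \<open>The entries padded with zeros impose no condition, so the two requirements on
    \<open>y\<close> amount to \<open>dual_certificate\<close>.\<close>
  have cert: "transpose (subcols I A) *v y = s \<and> infnorm (transpose (subcols (- I) A) *v y) < 1 \<longleftrightarrow>
      dual_certificate A xs y" for y
    unfolding assms(10,11) transpose_subcols_mult_eq_subvec_iff infnorm_transpose_subcols_less_1_iff
    by (simp add: dual_certificate_def sign_vec_def column_inner_eq_transpose)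
  show ?thesis
    unfolding S norm1_sublevel_singleton_iff cert unfolding assms(10)
    using norm1_deriv_pos[of xs A] rank_subcols_supp[of A xs] dual_certificate_exists[of A xs]
    by blast
qed

end
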